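(* Let $k\ge1$, $t\ge0$, $R=2^t$, $m=2R$, $1\le q\le k$, $N\ge0$, and $d=2RN+(q+1)R$. Fix $U\in\mathbb N^k$ with $|U|=N+q$ and $s=|\operatorname{Supp}(U)|\ge q$. The columns $$\mathrm{Sq}^R\bigl(g(U-\mathbf 1_J;J)\bigr)=\sum_{p\in J}f_{U,J\setminus\{p\}},$$ indexed by the $q$-element subsets $J$ of $\operatorname{Supp}(U)$, form (in the rows $f_{U,I}$, $I\subseteq\operatorname{Supp}(U)$, $|I|=q-1$) the augmented simplicial boundary matrix $$\partial_{q-1}:C_{q-1}(\Delta^{s-1};\mathbb F_2)\to C_{q-2}(\Delta^{s-1};\mathbb F_2).$$ Its rank is $\binom{s-1}{q-1}$. Distinct $U$ (with $|U|=N+q$ and $|\operatorname{Supp}(U)|\ge q$) give disjoint row sets. When $q=1$, the matrix is the augmentation matrix with $s$ columns and one row, and has rank one.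
   Context: $\mathbb N$ includes $0$. $\mathcal P_k=\mathbb F_2[x_1,\dots,x_k]$ with $\deg x_i=1$. For $e\in\mathbb N^k$, $x^e=\prod x_i^{e_i}$, $|e|=\sum e_i$, $\operatorname{Supp}(e)=\{i:e_i>0\}$; $\mathbf 1_J$ is the indicator vector of $J\subseteq\{1,\dots,k\}$. Steenrod squares act linearly by $\mathrm{Sq}^r(x^a)=\sum_{b\in\mathbb N^k,|b|=r}\prod_i\binom{a_i}{b_i}x^{a+b}$ (mod 2). For a $q$-element set $J\subseteq\{1,\dots,k\}$ and $A=(a_i)\in\mathbb N^k$ with $|A|=N$, $$g(A;J)=\prod_{j\in J}x_j^{ma_j+R}\prod_{j\notin J}x_j^{ma_j}.$$ For $U\in\mathbb N^k$ with $|U|=N+q$ and $I\subseteq\operatorname{Supp}(U)$ with $|I|=q-1$, $$f_{U,I}=\prod_{i\in I}x_i^{m(U_i-1)+R}\prod_{i\notin I}x_i^{mU_i}.$$ The row set of $U$ is the set of monomials $f_{U,I}$ with $I\subseteq\operatorname{Supp}(U)$, $|I|=q-1$. $\Delta^{s-1}$ is the full simplex on the $s$ vertices $\operatorname{Supp}(U)$; $C_{j-1}$ has as basis the $j$-element subsets of the vertex set (including the empty set for $j=0$, the augmentation convention), and the boundary of a $q$-element set $J$ is $\sum_{p\in J}J\setminus\{p\}$. *)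

theory Defs
  imports
    "HOL-Library.Poly_Mapping"
    "HOL-Library.Z2"
    "Jordan_Normal_Form.DL_Rank"
begin

text \<open>
  Polynomials over \<open>F\<^sub>2\<close> in the variables \<open>x\<^sub>1, x\<^sub>2, \<dots>\<close> are the monoid algebra of exponent
  vectors. The ring \<open>P\<^sub>k\<close> consists of those polynomials whose exponent vectors lie in
  \<open>exps k\<close>, which plays the role of \<open>N\<^sup>k\<close>.
\<close>

type_synonym expo = "nat \<Rightarrow>\<^sub>0 nat"
type_synonym f2poly = "expo \<Rightarrow>\<^sub>0 bit"

abbreviation Supp :: "expo \<Rightarrow> nat set" where
  "Supp e \<equiv> Poly_Mapping.keys e"

definition exps :: "nat \<Rightarrow> expo set" where
  "exps k = {e. Supp e \<subseteq> {1..k}}"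

definition weight :: "expo \<Rightarrow> nat" where
  "weight e = (\<Sum>i\<in>Supp e. Poly_Mapping.lookup e i)"

definition ind :: "nat set \<Rightarrow> expo" where
  "ind J = (\<Sum>j\<in>J. Poly_Mapping.single j 1)"

definition var :: "nat \<Rightarrow> f2poly" where
  "var i = Poly_Mapping.single (Poly_Mapping.single i 1) 1"

definition xpow :: "expo \<Rightarrow> f2poly" where
  "xpow e = Poly_Mapping.single e 1"

definition homogeneous :: "nat \<Rightarrow> nat \<Rightarrow> f2poly set" where
  "homogeneous k d = {p. \<forall>e\<in>Poly_Mapping.keys p. e \<in> exps k \<and> weight e = d}"

definition Sq :: "nat \<Rightarrow> nat \<Rightarrow> f2poly \<Rightarrow> f2poly" where
  "Sq k r p =
     (\<Sum>a\<in>Poly_Mapping.keys p. \<Sum>b\<in>{b \<in> exps k. weight b = r}.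
        Poly_Mapping.single (a + b)
          (Poly_Mapping.lookup p a *
           of_nat (\<Prod>i\<in>{1..k}. Poly_Mapping.lookup a i choose Poly_Mapping.lookup b i)))"

definition gmon :: "nat \<Rightarrow> nat \<Rightarrow> nat \<Rightarrow> expo \<Rightarrow> nat set \<Rightarrow> f2poly" where
  "gmon k m R A J =
     (\<Prod>j\<in>J. var j ^ (m * Poly_Mapping.lookup A j + R)) *
     (\<Prod>j\<in>{1..k} - J. var j ^ (m * Poly_Mapping.lookup A j))"

definition fmon :: "nat \<Rightarrow> nat \<Rightarrow> nat \<Rightarrow> expo \<Rightarrow> nat set \<Rightarrow> f2poly" where
  "fmon k m R U I =
     (\<Prod>i\<in>I. var i ^ (m * (Poly_Mapping.lookup U i - 1) + R)) *
     (\<Prod>i\<in>{1..k} - I. var i ^ (m * Poly_Mapping.lookup U i))"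

text \<open>Coefficient of the monomial \<open>\<mu> = xpow e\<close> in \<open>p\<close>; here \<open>keys \<mu> = {e}\<close>.\<close>

definition monomial_coeff :: "f2poly \<Rightarrow> f2poly \<Rightarrow> bit" where
  "monomial_coeff \<mu> p = Poly_Mapping.lookup p (the_elem (Poly_Mapping.keys \<mu>))"

definition faces :: "nat set \<Rightarrow> nat \<Rightarrow> nat set set" where
  "faces V j = {J. J \<subseteq> V \<and> card J = j}"

definition row_set :: "nat \<Rightarrow> nat \<Rightarrow> nat \<Rightarrow> nat \<Rightarrow> expo \<Rightarrow> f2poly set" where
  "row_set k m R q U = fmon k m R U ` faces (Supp U) (q - 1)"

text \<open>
  Chains on the full simplex with vertex set \<open>V\<close> are \<open>F\<^sub>2\<close>-combinations of finite subsets of \<open>V\<close>;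
  \<open>C\<^sub>j\<^sub>-\<^sub>1\<close> has basis \<open>faces V j\<close>. The boundary of a vertex is the empty set, so the complex is
  augmented.
\<close>

definition boundary :: "(nat set \<Rightarrow>\<^sub>0 bit) \<Rightarrow> (nat set \<Rightarrow>\<^sub>0 bit)" where
  "boundary c =
     (\<Sum>J\<in>Poly_Mapping.keys c. \<Sum>p\<in>J. Poly_Mapping.single (J - {p}) (Poly_Mapping.lookup c J))"

text \<open>
  Matrices are indexed by numbers, so the rows and columns are listed by enumerations of the
  index sets.
\<close>

definition enumerates :: "'a list \<Rightarrow> 'a set \<Rightarrow> bool" where
  "enumerates xs S \<longleftrightarrow> distinct xs \<and> set xs = S"

definition boundary_mat :: "nat set list \<Rightarrow> nat set list \<Rightarrow> bit mat" where
  "boundary_mat Is Js =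
     mat (length Is) (length Js)
       (\<lambda>(i, j). Poly_Mapping.lookup (boundary (Poly_Mapping.single (Js ! j) 1)) (Is ! i))"

definition Sq_mat ::
  "nat \<Rightarrow> nat \<Rightarrow> nat \<Rightarrow> expo \<Rightarrow> nat set list \<Rightarrow> nat set list \<Rightarrow> bit mat" where
  "Sq_mat k m R U Is Js =
     mat (length Is) (length Js)
       (\<lambda>(i, j). monomial_coeff (fmon k m R U (Is ! i))
                    (Sq k R (gmon k m R (U - ind (Js ! j)) (Js ! j))))"

definition mat_rank :: "bit mat \<Rightarrow> nat" where
  "mat_rank M = vec_space.rank (dim_row M) M"

lemma boundary_simplex:
  "boundary (Poly_Mapping.single J 1) = (\<Sum>p\<in>J. Poly_Mapping.single (J - {p}) 1)"
  by (simp add: boundary_def)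

text \<open>The index set of the inner sum of \<open>Sq\<close> is finite.\<close>

lemma finite_exps_weight: "finite {b \<in> exps k. weight b = r}"
proof -
  let ?S = "{b \<in> exps k. weight b = r}"
  have le: "Poly_Mapping.lookup b i \<le> r" if "b \<in> ?S" for b i
  proof (cases "i \<in> Poly_Mapping.keys b")
    case True
    then show ?thesis
      using that member_le_sum[of i "Poly_Mapping.keys b" "Poly_Mapping.lookup b"]
      by (auto simp: weight_def)
  next
    case False
    then show ?thesis by (simp add: in_keys_iff)
  qed
  have "Poly_Mapping.lookup ` ?S \<subseteq>
      {h. \<forall>i. (i \<in> {1..k} \<longrightarrow> h i \<in> {..r}) \<and> (i \<notin> {1..k} \<longrightarrow> h i = 0)}"
  proof (clarify)
    fix b i
    assume b: "b \<in> exps k" "r = weight b"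
    have "i \<notin> {1..k} \<Longrightarrow> Poly_Mapping.lookup b i = 0"
      using b(1) unfolding exps_def in_keys_iff[symmetric] by (auto simp: in_keys_iff)
    then show "(i \<in> {1..k} \<longrightarrow> Poly_Mapping.lookup b i \<in> {..weight b}) \<and>
        (i \<notin> {1..k} \<longrightarrow> Poly_Mapping.lookup b i = 0)"
      using le[of b i] b by auto
  qed
  then have "finite (Poly_Mapping.lookup ` ?S)"
    by (rule finite_subset) (rule finite_set_of_finite_funs, auto)
  then show ?thesis
    by (rule finite_imageD) (auto simp: inj_on_def poly_mapping_eqI)
qed

lemma xpow_add: "xpow (a + b) = xpow a * xpow b"
  by (simp add: xpow_def mult_single)

lemma var_power: "var i ^ n = xpow (Poly_Mapping.single i n)"
proof (induction n)
  case 0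
  then show ?case by (simp add: xpow_def)
next
  case (Suc n)
  then show ?case by (simp add: var_def xpow_def mult_single single_add[symmetric])
qed

lemma prod_var_power:
  "finite A \<Longrightarrow> (\<Prod>i\<in>A. var i ^ h i) = xpow (\<Sum>i\<in>A. Poly_Mapping.single i (h i))"
  by (induction A rule: finite_induct) (simp_all add: xpow_add var_power, simp add: xpow_def)

lemma monomial_coeff_xpow: "monomial_coeff (xpow e) p = Poly_Mapping.lookup p e"
  by (simp add: monomial_coeff_def xpow_def)

lemma Sq_xpow:
  "Sq k r (xpow a) =
     (\<Sum>b\<in>{b \<in> exps k. weight b = r}.
        of_nat (\<Prod>i\<in>{1..k}. Poly_Mapping.lookup a i choose Poly_Mapping.lookup b i) * xpow (a + b))"
proof -
  have *: "of_nat n * xpow e = Poly_Mapping.single e (of_nat n)" for n e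
    by (metis add_0 mult.right_neutral mult_single single_of_nat xpow_def)
  have keys: "Poly_Mapping.keys (xpow a) = {a}" and lookup: "Poly_Mapping.lookup (xpow a) a = 1"
    by (simp_all add: xpow_def)
  show ?thesis
    unfolding Sq_def * keys by (simp only: sum.insert sum.empty finite.emptyI empty_iff
      lookup mult_1_left add_0_right not_False_eq_True)
qed

end

theory Submission
  imports Defs
begin

text \<open>
  Every monomial in sight has all exponents divisible by \<open>R = 2 ^ t\<close>. For such a monomial \<open>x\<^sup>a\<close>
  the binomial coefficient of \<open>a\<^sub>i\<close> over \<open>b\<^sub>i\<close> is even whenever \<open>0 < b\<^sub>i < R\<close>, so in \<open>Sq\<^sup>R x\<^sup>a\<close>
  only the terms that add \<open>R\<close> to a single exponent \<open>a\<^sub>p\<close> survive, and these survive exactly when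
  \<open>a\<^sub>p / R\<close> is odd (\<open>Sq_two_power_xpow\<close>).

  The monomials \<open>f\<close> and \<open>g\<close> are instances of one formula: to a set \<open>I \<subseteq> Supp U\<close> belongs the
  monomial with exponents \<open>R (2 U\<^sub>i - [i \<in> I])\<close>. For a face \<open>I\<close> of size \<open>q - 1\<close> it is \<open>f\<close>, for a face
  \<open>J\<close> of size \<open>q\<close> it is \<open>g(U - 1\<^sub>J; J)\<close>. The odd quotients are precisely the ones indexed by \<open>J\<close>, and
  adding \<open>R\<close> at \<open>p \<in> J\<close> replaces \<open>J\<close> by \<open>J - {p}\<close>; this is the boundary formula (\<open>Sq_gmon\<close>). The
  parity of an exponent divided by \<open>R\<close> tells whether \<open>i \<in> I\<close>, and rounding up then recovers \<open>U\<^sub>i\<close>.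
  Hence a monomial determines both \<open>U\<close> and \<open>I\<close> (\<open>face_exp_eqD\<close>), which makes the row sets disjoint
  and lets coefficients be compared with those of the boundary (\<open>Sq_mat_eq_boundary_mat\<close>).

  For the rank, fix a vertex \<open>v\<close>. The column of a face \<open>J\<close> containing \<open>v\<close> has an entry \<open>1\<close> in row
  \<open>J - {v}\<close>, where all other such columns vanish; so these columns are independent. If \<open>v \<notin> J\<close>, then
  \<open>\<partial>\<partial>(J \<union> {v}) = 0\<close> expresses \<open>\<partial>J\<close> as a sum of the columns of faces containing \<open>v\<close>. The rank is
  therefore the number of \<open>q\<close>-element sets containing \<open>v\<close> (\<open>rank_boundary_mat\<close>).
\<close>

section \<open>Squares of monomials whose exponents are divisible by a power of two\<close>

text \<open>
  The identity \<open>b * (a choose b) = a * ((a - 1) choose (b - 1))\<close> makes \<open>2 ^ t\<close> divide the left side;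
  an odd binomial coefficient would force \<open>2 ^ t dvd b\<close>.
\<close>

lemma even_binomial_two_power:
  assumes "2 ^ t dvd (a :: nat)" and "0 < b" and "b < 2 ^ t"
  shows "even (a choose b)"
proof (rule ccontr)
  assume odd: "odd (a choose b)"
  have "2 ^ t dvd b * (a choose b)"
    using assms by (simp add: times_binomial_minus1_eq)
  moreover have "coprime (2 ^ t) (a choose b)"
    using odd by simp
  ultimately have "2 ^ t dvd b"
    by (simp add: coprime_dvd_mult_left_iff)
  then show False
    using assms by (auto dest: dvd_imp_le)
qed

text \<open>
  In Vandermonde's expansion of \<open>R * c + R\<close> over \<open>R = 2 ^ t\<close> all inner terms are even, so each step
  from \<open>c\<close> to \<open>c + 1\<close> changes the parity.
\<close>

lemma even_binomial_two_power_iff: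
  "even ((2 ^ t * c) choose (2 ^ t)) \<longleftrightarrow> even (c :: nat)"
proof (induction c)
  case 0
  then show ?case by (simp add: binomial_eq_0)
next
  case (Suc c)
  let ?R = "2 ^ t :: nat"
  let ?h = "\<lambda>b. (?R * c choose b) * (?R choose (?R - b))"
  have "(?R * Suc c) choose ?R = (\<Sum>b\<le>?R. ?h b)"
    unfolding vandermonde by (simp add: add.commute)
  also have "{..?R} = insert 0 (insert ?R {0<..<?R})"
    by auto
  also have "sum ?h \<dots> = 1 + (?R * c choose ?R) + sum ?h {0<..<?R}"
    by simp
  finally have split: "(?R * Suc c) choose ?R = 1 + (?R * c choose ?R) + sum ?h {0<..<?R}" .
  have "even (sum ?h {0<..<?R})"
    by (rule dvd_sum, rule dvd_mult2, rule even_binomial_two_power) auto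
  with split Suc.IH show ?case by simp
qed

lemma of_nat_f2poly: "(of_nat n :: f2poly) = of_bool (odd n)"
proof -
  have "(of_nat n :: bit) = of_bool (odd n)"
    by (induction n) auto
  then have "Poly_Mapping.single (0 :: expo) (of_nat n :: bit) =
      Poly_Mapping.single 0 (of_nat (of_bool (odd n)))"
    by simp
  then show ?thesis
    unfolding single_of_nat by simp
qed

lemma weight_eq_sum:
  assumes "e \<in> exps k"
  shows "weight e = (\<Sum>i\<in>{1..k}. Poly_Mapping.lookup e i)"
  unfolding weight_def
  by (rule sum.mono_neutral_left) (use assms in \<open>auto simp: exps_def in_keys_iff\<close>)

lemma lookup_le_weight: "Poly_Mapping.lookup e i \<le> weight e"
proof (cases "i \<in> Supp e")
  case True
  then show ?thesis
    unfolding weight_def by (intro member_le_sum) auto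
qed (simp add: in_keys_iff)

lemma eq_single_if_lookup_eq_weight:
  assumes "Poly_Mapping.lookup e i = weight e"
  shows "e = Poly_Mapping.single i (weight e)"
proof (rule poly_mapping_eqI)
  fix j
  show "Poly_Mapping.lookup e j = Poly_Mapping.lookup (Poly_Mapping.single i (weight e)) j"
  proof (cases "j = i")
    case False
    have "Poly_Mapping.lookup e j + Poly_Mapping.lookup e i \<le> weight e" if "j \<in> Supp e" "i \<in> Supp e"
    proof -
      have "(\<Sum>l\<in>{j, i}. Poly_Mapping.lookup e l) \<le> weight e"
        unfolding weight_def by (rule sum_mono2) (use that in auto)
      then show ?thesis using False by simp
    qed
    moreover have "Poly_Mapping.lookup e j \<le> weight e"
      by (rule lookup_le_weight)
    ultimately have "Poly_Mapping.lookup e j = 0"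
      using assms by (cases "j \<in> Supp e"; cases "i \<in> Supp e") (auto simp: in_keys_iff)
    then show ?thesis
      using False by (simp add: lookup_single)
  qed (simp add: assms)
qed

text \<open>
  An exponent vector \<open>b\<close> of weight \<open>2 ^ t\<close> with odd coefficient cannot have an entry strictly between
  \<open>0\<close> and \<open>2 ^ t\<close>, so its whole weight sits at one index.
\<close>

lemma Sq_two_power_xpow:
  assumes div: "\<And>i. i \<in> {1..k} \<Longrightarrow> 2 ^ t dvd Poly_Mapping.lookup a i"
  shows "Sq k (2 ^ t) (xpow a) =
    (\<Sum>p\<in>{p \<in> {1..k}. odd (Poly_Mapping.lookup a p div 2 ^ t)}.
       xpow (a + Poly_Mapping.single p (2 ^ t)))"
proof -
  let ?R = "2 ^ t :: nat"
  let ?P = "{p \<in> {1..k}. odd (Poly_Mapping.lookup a p div ?R)}"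
  let ?B = "{b \<in> exps k. weight b = ?R}"
  let ?c = "\<lambda>b. \<Prod>i\<in>{1..k}. Poly_Mapping.lookup a i choose Poly_Mapping.lookup b i"
  let ?s = "\<lambda>p :: nat. Poly_Mapping.single p ?R"
  have coeff_single: "odd (?c (?s p)) \<longleftrightarrow> p \<in> ?P" if p: "p \<in> {1..k}" for p
  proof -
    have "?c (?s p) = (\<Prod>i\<in>{1..k}. if i = p then Poly_Mapping.lookup a p choose ?R else 1)"
      by (rule prod.cong) (auto simp: lookup_single when_def)
    also have "\<dots> = (?R * (Poly_Mapping.lookup a p div ?R) choose ?R)"
      using p div[OF p] by simp
    finally show ?thesis
      using p by (simp add: even_binomial_two_power_iff)
  qed
  have zero: "even (?c b)" if b: "b \<in> ?B - ?s ` ?P" for b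
  proof (rule ccontr)
    assume odd: "odd (?c b)"
    have ex: "\<exists>p\<in>{1..k}. Poly_Mapping.lookup b p \<noteq> 0"
    proof (rule ccontr)
      assume none: "\<not> ?thesis"
      have "weight b = (\<Sum>i\<in>{1..k}. Poly_Mapping.lookup b i)"
        using b weight_eq_sum by blast
      also have "\<dots> = 0"
        by (rule sum.neutral) (use none in blast)
      finally have "weight b = 0" .
      then show False using b by simp
    qed
    then obtain p where p: "p \<in> {1..k}" "Poly_Mapping.lookup b p \<noteq> 0" by blast
    have "odd (Poly_Mapping.lookup a p choose Poly_Mapping.lookup b p)"
      using odd p(1) by (meson dvd_prodI dvd_trans finite_atLeastAtMost)
    then have "\<not> Poly_Mapping.lookup b p < ?R"
      using even_binomial_two_power[OF div[OF p(1)]] p(2) by blast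
    then have "Poly_Mapping.lookup b p = weight b"
      using lookup_le_weight[of b p] b by simp
    then have "b = ?s p"
      using eq_single_if_lookup_eq_weight[of b p] b by simp
    with coeff_single[OF p(1)] odd b show False by blast
  qed
  have sub: "?s ` ?P \<subseteq> ?B"
    by (auto simp: exps_def weight_def)
  have inj: "inj_on ?s ?P"
  proof (rule inj_onI)
    fix p p' assume "?s p = ?s p'"
    then have "Supp (?s p) = Supp (?s p')" by simp
    then show "p = p'" by simp
  qed
  have "Sq k ?R (xpow a) = (\<Sum>b\<in>?B. of_nat (?c b) * xpow (a + b))"
    by (rule Sq_xpow)
  also have "\<dots> = (\<Sum>b\<in>?s ` ?P. of_nat (?c b) * xpow (a + b))"
  proof (rule sum.mono_neutral_right[OF finite_exps_weight sub], rule ballI)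
    fix b assume "b \<in> ?B - ?s ` ?P"
    then have "(of_nat (?c b) :: f2poly) = 0"
      unfolding of_nat_f2poly using zero by simp
    then show "of_nat (?c b) * xpow (a + b) = 0" by (simp only: mult_zero_left)
  qed
  also have "\<dots> = (\<Sum>p\<in>?P. of_nat (?c (?s p)) * xpow (a + ?s p))"
    using inj by (simp only: sum.reindex comp_def)
  also have "\<dots> = (\<Sum>p\<in>?P. xpow (a + ?s p))"
  proof (rule sum.cong[OF refl])
    fix p assume "p \<in> ?P"
    then have "(of_nat (?c (?s p)) :: f2poly) = 1"
      unfolding of_nat_f2poly using coeff_single by simp
    then show "of_nat (?c (?s p)) * xpow (a + ?s p) = xpow (a + ?s p)" by (simp only: mult_1_left)
  qed
  finally show ?thesis .
qed

section \<open>Monomials attached to faces\<close>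

text \<open>
  The exponent vector of \<open>f\<^bsub>U,I\<^esub>\<close> for \<open>m = 2 R\<close>. No size is imposed on \<open>I\<close>, so that the same formula
  also gives the exponents of \<open>g(U - 1\<^sub>J; J)\<close> at \<open>I = J\<close>.
\<close>

definition face_exp :: "nat \<Rightarrow> nat \<Rightarrow> expo \<Rightarrow> nat set \<Rightarrow> expo" where
  "face_exp k R U I = (\<Sum>i\<in>{1..k}. Poly_Mapping.single i
     (if i \<in> I then 2 * R * (Poly_Mapping.lookup U i - 1) + R else 2 * R * Poly_Mapping.lookup U i))"

lemma lookup_sum_single:
  assumes "finite A"
  shows "Poly_Mapping.lookup (\<Sum>i\<in>A. Poly_Mapping.single i (h i)) j = (if j \<in> A then h j else 0)"
  using assms by (simp add: lookup_sum lookup_single when_def)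

lemma lookup_eq_zero_outside: "U \<in> exps k \<Longrightarrow> i \<notin> {1..k} \<Longrightarrow> Poly_Mapping.lookup U i = 0"
  by (auto simp: exps_def in_keys_iff)

text \<open>
  Because \<open>I\<close> lies in the support of \<open>U\<close>, the truncated subtractions are genuine, and the two cases of
  the definition merge into a form whose quotient by \<open>R\<close> has a visible parity.
\<close>

lemma lookup_face_exp:
  assumes "U \<in> exps k" and "I \<subseteq> Supp U"
  shows "Poly_Mapping.lookup (face_exp k R U I) i =
    R * (2 * Poly_Mapping.lookup U i - of_bool (i \<in> I))"
proof -
  have pos: "Poly_Mapping.lookup U i > 0" if "i \<in> I"
    using that assms(2) by (auto simp: in_keys_iff)
  have "2 * R * (u - 1) + R = R * (2 * u - 1)" if "u > 0" for u :: nat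
    using that by (cases u) (auto simp: algebra_simps)
  moreover have "i \<in> {1..k}" if "i \<in> I"
    using that assms unfolding exps_def by blast
  ultimately show ?thesis
    using lookup_eq_zero_outside[OF assms(1), of i] pos
    by (auto simp: face_exp_def lookup_sum_single)
qed

lemma face_exp_in_exps: "face_exp k R U I \<in> exps k"
  by (auto simp: exps_def face_exp_def in_keys_iff lookup_sum_single split: if_splits)

lemma double_minus_of_bool_eqD:
  fixes u v :: nat
  assumes "2 * u - of_bool P = 2 * v - of_bool Q" and "P \<Longrightarrow> u > 0" and "Q \<Longrightarrow> v > 0"
  shows "u = v \<and> (P \<longleftrightarrow> Q)"
proof -
  have "odd (2 * u - of_bool P) \<longleftrightarrow> P"
    using assms(2) by (cases P) auto
  moreover have "odd (2 * v - of_bool Q) \<longleftrightarrow> Q"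
    using assms(3) by (cases Q) auto
  ultimately have "P \<longleftrightarrow> Q" by (simp only: assms(1))
  moreover have "u = v"
    using assms \<open>P \<longleftrightarrow> Q\<close> by (cases P) auto
  ultimately show ?thesis by simp
qed

text \<open>
  Parity of the exponents divided by \<open>R\<close> recovers the face, and then their size recovers \<open>U\<close>.
\<close>

lemma face_exp_eqD:
  assumes "R > 0"
    and "U \<in> exps k" "I \<subseteq> Supp U"
    and "V \<in> exps k" "I' \<subseteq> Supp V"
    and eq: "face_exp k R U I = face_exp k R V I'"
  shows "U = V" and "I = I'"
proof -
  have *: "Poly_Mapping.lookup U i = Poly_Mapping.lookup V i \<and> (i \<in> I \<longleftrightarrow> i \<in> I')" for i
  proof -
    have "R * (2 * Poly_Mapping.lookup U i - of_bool (i \<in> I)) =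
        R * (2 * Poly_Mapping.lookup V i - of_bool (i \<in> I'))"
      using arg_cong[OF eq, of "\<lambda>e. Poly_Mapping.lookup e i"]
      by (simp only: lookup_face_exp[OF assms(2,3)] lookup_face_exp[OF assms(4,5)])
    then have "2 * Poly_Mapping.lookup U i - of_bool (i \<in> I) =
        2 * Poly_Mapping.lookup V i - of_bool (i \<in> I')"
      using \<open>R > 0\<close> by simp
    moreover have "i \<in> I \<Longrightarrow> Poly_Mapping.lookup U i > 0" "i \<in> I' \<Longrightarrow> Poly_Mapping.lookup V i > 0"
      using assms by (auto simp: in_keys_iff)
    ultimately show ?thesis
      by (rule double_minus_of_bool_eqD)
  qed
  show "U = V" by (rule poly_mapping_eqI) (simp add: *)
  show "I = I'" using * by blast
qed

text \<open>
  The weight is stated additively, since each element of \<open>I\<close> lowers an exponent of \<open>x\<^bsup>2RU\<^esup>\<close> by \<open>R\<close>.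
\<close>

lemma weight_face_exp:
  assumes "U \<in> exps k" and "I \<subseteq> Supp U"
  shows "weight (face_exp k R U I) + R * card I = 2 * R * weight U"
proof -
  have I: "I \<subseteq> {1..k}"
    using assms unfolding exps_def by blast
  have "R * card I = (\<Sum>i\<in>{1..k}. R * of_bool (i \<in> I))"
    using I by (simp add: sum_distrib_left[symmetric] Int_absorb1)
  moreover have "weight (face_exp k R U I) =
      (\<Sum>i\<in>{1..k}. R * (2 * Poly_Mapping.lookup U i - of_bool (i \<in> I)))"
    using assms by (simp add: weight_eq_sum[OF face_exp_in_exps] lookup_face_exp)
  ultimately have "weight (face_exp k R U I) + R * card I =
      (\<Sum>i\<in>{1..k}. R * (2 * Poly_Mapping.lookup U i - of_bool (i \<in> I)) + R * of_bool (i \<in> I))"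
    by (simp add: sum.distrib)
  also have "\<dots> = (\<Sum>i\<in>{1..k}. 2 * R * Poly_Mapping.lookup U i)"
  proof (rule sum.cong[OF refl])
    fix i
    have "i \<in> I \<Longrightarrow> Poly_Mapping.lookup U i > 0"
      using assms by (auto simp: in_keys_iff)
    then have "2 * Poly_Mapping.lookup U i - of_bool (i \<in> I) + of_bool (i \<in> I) =
        2 * Poly_Mapping.lookup U i"
      by auto
    then show "R * (2 * Poly_Mapping.lookup U i - of_bool (i \<in> I)) + R * of_bool (i \<in> I) =
        2 * R * Poly_Mapping.lookup U i"
      by (metis distrib_left mult.assoc mult.commute)
  qed
  also have "\<dots> = 2 * R * weight U"
    by (simp add: weight_eq_sum[OF assms(1)] sum_distrib_left)
  finally show ?thesis .
qed

lemma split_monomial: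
  assumes "I \<subseteq> {1..k}"
  shows "(\<Prod>i\<in>I. var i ^ f i) * (\<Prod>i\<in>{1..k} - I. var i ^ g i) =
    xpow (\<Sum>i\<in>{1..k}. Poly_Mapping.single i (if i \<in> I then f i else g i))"
proof -
  have "(\<Prod>i\<in>I. var i ^ f i) * (\<Prod>i\<in>{1..k} - I. var i ^ g i) =
      (\<Prod>i\<in>{1..k}. var i ^ (if i \<in> I then f i else g i))"
    using prod.subset_diff[OF assms, of "\<lambda>i. var i ^ (if i \<in> I then f i else g i)"]
    by (simp add: mult.commute)
  then show ?thesis by (simp add: prod_var_power)
qed

lemma fmon_eq_xpow:
  assumes "I \<subseteq> {1..k}"
  shows "fmon k (2 * R) R U I = xpow (face_exp k R U I)"
  unfolding fmon_def face_exp_def split_monomial[OF assms] ..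

lemma gmon_eq_xpow:
  assumes "J \<subseteq> {1..k}"
  shows "gmon k (2 * R) R (U - ind J) J = xpow (face_exp k R U J)"
proof -
  have "finite J" using assms finite_subset by blast
  then have "Poly_Mapping.lookup (ind J) i = of_bool (i \<in> J)" for i
    by (simp add: ind_def lookup_sum_single)
  then show ?thesis
    unfolding gmon_def face_exp_def split_monomial[OF assms]
    by (intro arg_cong[of _ _ xpow] sum.cong) (auto simp: lookup_minus)
qed

lemma xpow_eq_iff: "xpow e = xpow e' \<longleftrightarrow> e = e'"
proof
  assume "xpow e = xpow e'"
  then have "Poly_Mapping.keys (xpow e) = Poly_Mapping.keys (xpow e')" by simp
  then show "e = e'" by (simp add: xpow_def)
qed simp

text \<open>
  The exponents divided by \<open>R\<close> are odd exactly on \<open>J\<close>, and raising the exponent at \<open>p \<in> J\<close> by \<open>R\<close>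
  turns \<open>R (2 U\<^sub>p - 1)\<close> into \<open>2 R U\<^sub>p\<close>, that is, removes \<open>p\<close> from the face.
\<close>

lemma Sq_gmon:
  assumes R: "R = 2 ^ t" and U: "U \<in> exps k" and J: "J \<subseteq> Supp U"
  shows "Sq k R (gmon k (2 * R) R (U - ind J) J) = (\<Sum>p\<in>J. fmon k (2 * R) R U (J - {p}))"
proof -
  have Jk: "J \<subseteq> {1..k}" using U J unfolding exps_def by blast
  have pos: "R > 0" using R by simp
  have Upos: "Poly_Mapping.lookup U i > 0" if "i \<in> J" for i
    using that J by (auto simp: in_keys_iff)
  have "odd (Poly_Mapping.lookup (face_exp k R U J) i div R) \<longleftrightarrow> i \<in> J" for i
    using pos Upos[of i] by (simp add: lookup_face_exp[OF U J])
  then have "{p \<in> {1..k}. odd (Poly_Mapping.lookup (face_exp k R U J) p div R)} = J"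
    using Jk by auto
  moreover have "face_exp k R U J + Poly_Mapping.single p R = face_exp k R U (J - {p})"
    if p: "p \<in> J" for p
  proof (rule poly_mapping_eqI)
    fix i
    have "J - {p} \<subseteq> Supp U" using J by blast
    moreover have "R * (2 * u - 1) + R = R * (2 * u)" if "u > 0" for u
      using that by (cases u) (auto simp: algebra_simps)
    ultimately show "Poly_Mapping.lookup (face_exp k R U J + Poly_Mapping.single p R) i =
        Poly_Mapping.lookup (face_exp k R U (J - {p})) i"
      using p Upos[OF p]
      by (auto simp: lookup_add lookup_single when_def lookup_face_exp[OF U] J)
  qed
  ultimately have "Sq k R (xpow (face_exp k R U J)) = (\<Sum>p\<in>J. xpow (face_exp k R U (J - {p})))"
    using Sq_two_power_xpow[of k t "face_exp k R U J"] R lookup_face_exp[OF U J]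
    by simp
  moreover have "fmon k (2 * R) R U (J - {p}) = xpow (face_exp k R U (J - {p}))" for p
    using Jk by (intro fmon_eq_xpow) blast
  ultimately show ?thesis
    by (simp add: gmon_eq_xpow[OF Jk])
qed

section \<open>The rank of a simplicial boundary matrix\<close>

text \<open>
  The terms for \<open>(p, r)\<close> and \<open>(r, p)\<close> cancel in characteristic two.
\<close>

lemma sum_symmetric_off_diagonal:
  fixes h :: "'a \<Rightarrow> 'a \<Rightarrow> 'b :: comm_monoid_add"
  assumes "finite K" and char2: "\<And>x :: 'b. x + x = 0" and sym: "\<And>p r. h p r = h r p"
  shows "(\<Sum>p\<in>K. \<Sum>r\<in>K - {p}. h p r) = 0"
  using assms(1)
proof (induction K rule: finite_induct)
  case (insert x K)
  have "(\<Sum>p\<in>K. \<Sum>r\<in>insert x K - {p}. h p r) = (\<Sum>p\<in>K. h p x + (\<Sum>r\<in>K - {p}. h p r))"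
  proof (rule sum.cong[OF refl])
    fix p assume "p \<in> K"
    then have "insert x K - {p} = insert x (K - {p})" "x \<notin> K - {p}" "finite (K - {p})"
      using insert.hyps by auto
    then show "(\<Sum>r\<in>insert x K - {p}. h p r) = h p x + (\<Sum>r\<in>K - {p}. h p r)" by simp
  qed
  also have "\<dots> = (\<Sum>p\<in>K. h x p)"
    using insert.IH sym by (simp add: sum.distrib)
  finally have "(\<Sum>p\<in>insert x K. \<Sum>r\<in>insert x K - {p}. h p r) = (\<Sum>p\<in>K. h x p) + (\<Sum>p\<in>K. h x p)"
    using insert.hyps by simp
  then show ?case by (simp only: char2)
qed simp

text \<open>
  This is \<open>\<partial>\<partial> = 0\<close> on a simplex, with the inner boundary expanded: removing two vertices in either order
  gives the same set.
\<close>

lemma boundary_boundary_simplex: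
  assumes "finite K"
  shows "(\<Sum>p\<in>K. boundary (Poly_Mapping.single (K - {p}) 1)) = 0"
proof -
  have "x + x = 0" for x :: "nat set \<Rightarrow>\<^sub>0 bit"
    by (rule poly_mapping_eqI) (simp add: lookup_add)
  moreover have "K - {p} - {r} = K - {r} - {p}" for p r by blast
  ultimately show ?thesis
    unfolding boundary_simplex
    by (intro sum_symmetric_off_diagonal assms) simp_all
qed

text \<open>
  In \<open>\<partial>\<partial>(J \<union> {v}) = 0\<close> the term that omits \<open>v\<close> is \<open>\<partial>J\<close>; all others come from faces containing \<open>v\<close>.
\<close>

lemma boundary_as_sum_of_cones:
  assumes "finite J" and "v \<notin> J"
  shows "boundary (Poly_Mapping.single J 1) =
    (\<Sum>p\<in>J. boundary (Poly_Mapping.single (insert v (J - {p})) 1))"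
proof -
  let ?\<Sigma> = "\<Sum>p\<in>J. boundary (Poly_Mapping.single (insert v (J - {p})) 1)"
  have "(\<Sum>p\<in>J. boundary (Poly_Mapping.single (insert v J - {p}) 1)) = ?\<Sigma>"
  proof (rule sum.cong[OF refl])
    fix p assume "p \<in> J"
    then have "insert v J - {p} = insert v (J - {p})" using assms(2) by blast
    then show "boundary (Poly_Mapping.single (insert v J - {p}) 1) =
        boundary (Poly_Mapping.single (insert v (J - {p})) 1)" by simp
  qed
  moreover have "insert v J - {v} = J" using assms(2) by blast
  ultimately have zero: "boundary (Poly_Mapping.single J 1) + ?\<Sigma> = 0"
    using boundary_boundary_simplex[of "insert v J"] assms by simp
  show ?thesis
  proof (rule poly_mapping_eqI)
    fix I
    have "Poly_Mapping.lookup (boundary (Poly_Mapping.single J 1)) I +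
        Poly_Mapping.lookup ?\<Sigma> I = 0"
      using arg_cong[OF zero, of "\<lambda>c. Poly_Mapping.lookup c I"] by (simp add: lookup_add)
    then show "Poly_Mapping.lookup (boundary (Poly_Mapping.single J 1)) I =
        Poly_Mapping.lookup ?\<Sigma> I"
      by (cases "Poly_Mapping.lookup ?\<Sigma> I") auto
  qed
qed

lemma lookup_boundary_simplex:
  assumes "finite J"
  shows "Poly_Mapping.lookup (boundary (Poly_Mapping.single J 1)) I =
    of_bool (\<exists>p\<in>J. I = J - {p})"
proof (cases "\<exists>p\<in>J. I = J - {p}")
  case True
  then obtain p where p: "p \<in> J" "I = J - {p}" by blast
  have "(J - {p'} = I) = (p' = p)" if "p' \<in> J" for p'
    using p that by blast
  then have "(\<Sum>p'\<in>J. Poly_Mapping.lookup (Poly_Mapping.single (J - {p'}) (1 :: bit)) I) =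
      (\<Sum>p'\<in>J. if p' = p then 1 else 0)"
    by (intro sum.cong) (auto simp: lookup_single when_def)
  then show ?thesis
    using True p assms by (simp add: boundary_simplex lookup_sum)
next
  case False
  then have "(\<Sum>p'\<in>J. Poly_Mapping.lookup (Poly_Mapping.single (J - {p'}) (1 :: bit)) I) = 0"
    by (intro sum.neutral) (auto simp: lookup_single when_def)
  then show ?thesis
    using False by (simp add: boundary_simplex lookup_sum)
qed

text \<open>
  The pivot rows make the columns in \<open>P\<close> independent, since in a vanishing linear combination each of
  them isolates one coefficient. The columns in \<open>P\<close> also span all others, so they form a maximal
  independent set of columns.
\<close>

lemma (in vec_space) rank_eq_card_pivot_columns:
  assumes A: "A \<in> carrier_mat n nc" and P: "P \<subseteq> {..<nc}"
    and pivot: "\<And>j. j \<in> P \<Longrightarrow> \<exists>i<n. A $$ (i, j) \<noteq> 0 \<and> (\<forall>l\<in>P - {j}. A $$ (i, l) = 0)"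
    and other: "\<And>j. j < nc \<Longrightarrow> j \<notin> P \<Longrightarrow>
      \<exists>Q\<subseteq>P. \<forall>i<n. A $$ (i, j) = (\<Sum>l\<in>Q. A $$ (i, l))"
  shows "rank A = card P"
proof -
  let ?S = "col A ` P"
  have entry: "col A j $ i = A $$ (i, j)" if "i < n" "j < nc" for i j
    using that A by simp
  have carrier: "col A j \<in> carrier_vec n" for j
    using A by (auto simp: carrier_matD)
  then have S_carrier: "?S \<subseteq> carrier_vec n" by blast
  have inj: "inj_on (col A) P"
  proof (rule inj_onI, rule ccontr)
    fix j l assume jl: "j \<in> P" "l \<in> P" "col A j = col A l" "j \<noteq> l"
    obtain i where i: "i < n" "A $$ (i, j) \<noteq> 0" "A $$ (i, l) = 0"
      using pivot[OF jl(1)] jl by auto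
    have "j < nc" "l < nc" using jl P by auto
    then show False using entry[OF i(1), of j] entry[OF i(1), of l] jl(3) i by simp
  qed
  have indpt: "lin_indpt ?S"
  proof
    assume "lin_dep ?S"
    then obtain B a v where B: "finite B" "B \<subseteq> ?S" "lincomb a B = 0\<^sub>v n" "v \<in> B" "a v \<noteq> 0"
      unfolding lin_dep_def by auto
    obtain j where j: "j \<in> P" "v = col A j" using B by blast
    obtain i where i: "i < n" "A $$ (i, j) \<noteq> 0" "\<forall>l\<in>P - {j}. A $$ (i, l) = 0"
      using pivot[OF j(1)] by blast
    \<comment> \<open>In the pivot row \<open>i\<close> of \<open>v\<close>, the combination reduces to the single term of \<open>v\<close>.\<close>
    have "w $ i = 0" if w: "w \<in> B - {v}" for w
    proof -
      obtain l where l: "l \<in> P" "w = col A l" using w B by blast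
      then have "l \<in> P - {j}" using w j by blast
      then show ?thesis using i l entry[of i l] P by auto
    qed
    then have "(\<Sum>w\<in>B. a w * w $ i) = (\<Sum>w\<in>{v}. a w * w $ i)"
      by (intro sum.mono_neutral_right) (use B in auto)
    moreover have "v $ i \<noteq> 0" using i j entry[of i j] P by auto
    moreover have "(\<Sum>w\<in>B. a w * w $ i) = 0"
      using lincomb_index[OF i(1), of B a] B S_carrier i(1) by auto
    ultimately show False using B by simp
  qed
  have span: "col A j \<in> span ?S" if j: "j < nc" for j
  proof (cases "j \<in> P")
    case True
    then show ?thesis using in_own_span[of ?S] S_carrier by auto
  next
    case False
    then obtain Q where Q: "Q \<subseteq> P" "\<forall>i<n. A $$ (i, j) = (\<Sum>l\<in>Q. A $$ (i, l))"
      using other[OF j] by blast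
    have finQ: "finite Q" using Q P by (meson finite_lessThan finite_subset)
    have injQ: "inj_on (col A) Q" using inj Q(1) by (rule inj_on_subset)
    have Q_carrier: "col A ` Q \<subseteq> carrier_vec n" using carrier by blast
    have "col A j = lincomb (\<lambda>_. 1) (col A ` Q)"
    proof (rule eq_vecI)
      show "dim_vec (col A j) = dim_vec (lincomb (\<lambda>_. 1) (col A ` Q))"
        using lincomb_dim[OF finite_imageI[OF finQ] Q_carrier] A by simp
      fix i assume "i < dim_vec (lincomb (\<lambda>_. 1) (col A ` Q))"
      then have i: "i < n" using lincomb_dim[OF finite_imageI[OF finQ] Q_carrier] by simp
      have "lincomb (\<lambda>_. 1) (col A ` Q) $ i = (\<Sum>l\<in>Q. col A l $ i)"
        unfolding lincomb_index[OF i Q_carrier] using injQ by (simp add: sum.reindex)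
      also have "\<dots> = (\<Sum>l\<in>Q. A $$ (i, l))"
        by (rule sum.cong) (use Q P i entry in auto)
      finally show "col A j $ i = lincomb (\<lambda>_. 1) (col A ` Q) $ i"
        using Q i j entry by simp
    qed
    then show ?thesis using finQ Q by (intro in_spanI[of _ "\<lambda>_. 1" "col A ` Q"]) auto
  qed
  have cols: "set (cols A) = col A ` {..<nc}"
    using A by (auto simp: cols_def)
  have "maximal ?S (\<lambda>T. T \<subseteq> set (cols A) \<and> lin_indpt T)"
    unfolding maximal_def
  proof (intro conjI allI impI)
    show "?S \<subseteq> set (cols A)" using P cols by auto
    show "lin_indpt ?S" by (rule indpt)
    fix T assume T: "?S \<subseteq> T \<and> T \<subseteq> set (cols A) \<and> lin_indpt T"
    show "T = ?S"
    proof (rule ccontr)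
      assume "T \<noteq> ?S"
      then obtain v where v: "v \<in> T" "v \<notin> ?S" using T by blast
      then have "v \<in> span ?S" "v \<in> carrier_vec n" using T cols span carrier by auto
      then have "lin_dep (?S \<union> {v})"
        using lin_dep_iff_in_span[OF _ indpt _ v(2)] S_carrier by simp
      moreover have "?S \<union> {v} \<subseteq> T" using T v by blast
      ultimately show False using T subset_li_is_li by blast
    qed
  qed
  then have "rank A = card ?S" by (rule rank_card_indpt[OF A])
  then show ?thesis using inj by (simp add: card_image)
qed

lemma card_faces_containing:
  assumes "finite V" and "v \<in> V" and "q \<ge> 1"
  shows "card {J \<in> faces V q. v \<in> J} = (card V - 1) choose (q - 1)"
proof -
  have "bij_betw (insert v) (faces (V - {v}) (q - 1)) {J \<in> faces V q. v \<in> J}"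
  proof (rule bij_betw_byWitness[where f' = "\<lambda>J. J - {v}"])
    show "insert v ` faces (V - {v}) (q - 1) \<subseteq> {J \<in> faces V q. v \<in> J}"
    proof
      fix J assume "J \<in> insert v ` faces (V - {v}) (q - 1)"
      then obtain I where I: "J = insert v I" "I \<subseteq> V - {v}" "card I = q - 1"
        by (auto simp: faces_def)
      then have "finite I" "v \<notin> I" using assms(1) by (auto intro: finite_subset)
      then show "J \<in> {J \<in> faces V q. v \<in> J}" using I assms by (auto simp: faces_def)
    qed
    show "(\<lambda>J. J - {v}) ` {J \<in> faces V q. v \<in> J} \<subseteq> faces (V - {v}) (q - 1)"
      by (auto simp: faces_def)
  qed (auto simp: faces_def)
  then have "card {J \<in> faces V q. v \<in> J} = card (faces (V - {v}) (q - 1))"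
    by (simp add: bij_betw_same_card)
  also have "\<dots> = (card V - 1) choose (q - 1)"
    using n_subsets[of "V - {v}" "q - 1"] assms by (simp add: faces_def)
  finally show ?thesis .
qed

text \<open>
  The columns of the faces through a fixed vertex \<open>v\<close> serve as pivot columns: the pivot row of \<open>J\<close> is
  \<open>J - {v}\<close>, and a face through \<open>v\<close> having \<open>J - {v}\<close> in its boundary must be \<open>J\<close> itself.
\<close>

lemma rank_boundary_mat:
  assumes V: "finite V" "V \<noteq> {}" and q: "q \<ge> 1"
    and Is: "enumerates Is (faces V (q - 1))" and Js: "enumerates Js (faces V q)"
  shows "mat_rank (boundary_mat Is Js) = (card V - 1) choose (q - 1)"
proof -
  obtain v where v: "v \<in> V" using V by blast
  let ?A = "boundary_mat Is Js"
  let ?d = "\<lambda>I J. Poly_Mapping.lookup (boundary (Poly_Mapping.single J 1)) I"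
  define P where "P = {j. j < length Js \<and> v \<in> Js ! j}"
  have A: "?A \<in> carrier_mat (length Is) (length Js)"
    by (simp add: boundary_mat_def)
  have entry: "?A $$ (i, j) = ?d (Is ! i) (Js ! j)" if "i < length Is" "j < length Js" for i j
    using that by (simp add: boundary_mat_def)
  have face: "Js ! j \<subseteq> V" "card (Js ! j) = q" "finite (Js ! j)" if "j < length Js" for j
  proof -
    have "Js ! j \<in> faces V q" using that Js nth_mem unfolding enumerates_def by blast
    then show "Js ! j \<subseteq> V" "card (Js ! j) = q" "finite (Js ! j)"
      using V finite_subset unfolding faces_def by auto
  qed
  have nth_inj: "inj_on ((!) Js) {..<length Js}"
    using Js unfolding enumerates_def by (simp add: inj_on_nth)
  have pivot: "\<exists>i<length Is. ?A $$ (i, j) \<noteq> 0 \<and> (\<forall>l\<in>P - {j}. ?A $$ (i, l) = 0)"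
    if j: "j \<in> P" for j
  proof -
    have jl: "j < length Js" and vj: "v \<in> Js ! j" using j by (auto simp: P_def)
    have "Js ! j - {v} \<in> faces V (q - 1)"
      using face[OF jl] vj by (auto simp: faces_def)
    then obtain i where i: "i < length Is" "Is ! i = Js ! j - {v}"
      using Is unfolding enumerates_def by (metis in_set_conv_nth)
    have "?A $$ (i, l) = 0" if l: "l \<in> P - {j}" for l
    proof -
      have ll: "l < length Js" "v \<in> Js ! l" "l \<noteq> j" using l by (auto simp: P_def)
      have "Js ! l \<noteq> Js ! j" using nth_inj ll jl by (auto simp: inj_on_def)
      then have "\<not> (\<exists>p\<in>Js ! l. Js ! j - {v} = Js ! l - {p})"
        using vj ll(2) by blast
      then show ?thesis
        using entry[OF i(1) ll(1)] i(2) face[OF ll(1)] by (simp add: lookup_boundary_simplex)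
    qed
    moreover have "?A $$ (i, j) \<noteq> 0"
      using entry[OF i(1) jl] i(2) vj face[OF jl] by (auto simp: lookup_boundary_simplex)
    ultimately show ?thesis using i(1) by blast
  qed
  have other: "\<exists>Q\<subseteq>P. \<forall>i<length Is. ?A $$ (i, j) = (\<Sum>l\<in>Q. ?A $$ (i, l))"
    if j: "j < length Js" "j \<notin> P" for j
  proof -
    let ?J = "Js ! j"
    have vJ: "v \<notin> ?J" using j by (simp add: P_def)
    let ?cone = "\<lambda>p. insert v (?J - {p})"
    \<comment> \<open>\<open>Q\<close> lists the columns of the cones over the facets of \<open>J\<close> with apex \<open>v\<close>.\<close>
    define Q where "Q = {l. l < length Js \<and> Js ! l \<in> ?cone ` ?J}"
    have "?cone p \<in> set Js" if "p \<in> ?J" for p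
    proof -
      have "card (?cone p) = q"
        using that face[OF j(1)] vJ q by simp
      then have "?cone p \<in> faces V q"
        using face[OF j(1)] v by (auto simp: faces_def)
      then show ?thesis using Js by (simp add: enumerates_def)
    qed
    then have image: "(!) Js ` Q = ?cone ` ?J"
      unfolding Q_def by (fastforce simp: in_set_conv_nth)
    have inj_cone: "inj_on ?cone ?J"
      using vJ by (auto simp: inj_on_def)
    have "?A $$ (i, j) = (\<Sum>l\<in>Q. ?A $$ (i, l))" if i: "i < length Is" for i
    proof -
      have "?A $$ (i, j) = (\<Sum>p\<in>?J. ?d (Is ! i) (?cone p))"
        using entry[OF i j(1)] boundary_as_sum_of_cones[OF face(3)[OF j(1)] vJ]
        by (simp add: lookup_sum)
      also have "\<dots> = (\<Sum>J\<in>?cone ` ?J. ?d (Is ! i) J)"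
        using inj_cone by (simp add: sum.reindex)
      also have "\<dots> = (\<Sum>l\<in>Q. ?d (Is ! i) (Js ! l))"
        unfolding image[symmetric]
        using inj_on_subset[OF nth_inj, of Q] by (subst sum.reindex) (auto simp: Q_def)
      also have "\<dots> = (\<Sum>l\<in>Q. ?A $$ (i, l))"
        by (rule sum.cong) (auto simp: Q_def entry[OF i])
      finally show ?thesis .
    qed
    moreover have "Q \<subseteq> P" by (auto simp: Q_def P_def)
    ultimately show ?thesis by blast
  qed
  have "P \<subseteq> {..<length Js}" by (auto simp: P_def)
  then have "vec_space.rank (length Is) ?A = card P"
    by (rule vec_space.rank_eq_card_pivot_columns[OF A _ pivot other])
  moreover have "card P = card ((!) Js ` P)"
    using inj_on_subset[OF nth_inj, of P] by (subst card_image) (auto simp: P_def)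
  moreover have "(!) Js ` P = {J \<in> faces V q. v \<in> J}"
  proof -
    have "(!) Js ` P = {J \<in> set Js. v \<in> J}"
      by (auto simp: P_def in_set_conv_nth)
    then show ?thesis using Js by (simp add: enumerates_def)
  qed
  moreover have "dim_row ?A = length Is" by (simp add: boundary_mat_def)
  ultimately show ?thesis
    unfolding mat_rank_def using card_faces_containing[OF V(1) v q] by simp
qed

text \<open>
  By the augmentation convention every vertex has the empty set as its boundary, and the empty set is
  the only row.
\<close>

lemma boundary_mat_vertices:
  assumes "finite V" and "enumerates Is (faces V 0)" and "enumerates Js (faces V 1)"
  shows "boundary_mat Is Js = mat 1 (card V) (\<lambda>_. 1)"
proof -
  have "faces V 0 = {{}}"
    using assms(1) by (auto simp: faces_def dest: finite_subset)
  then have "set Is = {{}}" and "distinct Is"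
    using assms(2) by (auto simp: enumerates_def)
  moreover from this have "length Is = Suc 0"
    using distinct_card[of Is] by simp
  then obtain I where "Is = [I]" by (metis length_0_conv length_Suc_conv)
  ultimately have Is: "Is = [{}]" by simp
  have "card (faces V 1) = card V"
    using n_subsets[OF assms(1), of 1] by (simp add: faces_def)
  then have len: "length Js = card V"
    using assms(3) unfolding enumerates_def by (metis distinct_card)
  have "Poly_Mapping.lookup (boundary (Poly_Mapping.single (Js ! j) 1)) {} = 1"
    if "j < length Js" for j
  proof -
    have "Js ! j \<in> faces V 1" using that assms(3) nth_mem unfolding enumerates_def by blast
    then obtain w where "Js ! j = {w}" by (auto simp: faces_def card_1_singleton_iff)
    then show ?thesis by (simp add: lookup_boundary_simplex)
  qed
  then show ?thesis
    by (intro eq_matI) (auto simp: boundary_mat_def Is len)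
qed

section \<open>The columns as a boundary matrix\<close>

text \<open>
  Distinct faces give distinct monomials, so the coefficient of the row monomial of \<open>I\<close> in
  \<open>\<Sum>p\<in>J. f\<^bsub>U,J-{p}\<^esub>\<close> counts the same \<open>p\<close> as the coefficient of \<open>I\<close> in \<open>\<partial>J\<close>.
\<close>

lemma Sq_mat_eq_boundary_mat:
  assumes R: "R = 2 ^ t" and U: "U \<in> exps k" and V: "V = Supp U"
    and Is: "enumerates Is (faces V (q - 1))" and Js: "enumerates Js (faces V q)"
  shows "Sq_mat k (2 * R) R U Is Js = boundary_mat Is Js"
proof (rule eq_matI)
  fix i j
  assume "i < dim_row (boundary_mat Is Js)" "j < dim_col (boundary_mat Is Js)"
  then have i: "i < length Is" and j: "j < length Js" by (auto simp: boundary_mat_def)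
  let ?I = "Is ! i" and ?J = "Js ! j"
  have I: "?I \<subseteq> Supp U" using i Is nth_mem unfolding enumerates_def faces_def V by blast
  have J: "?J \<subseteq> Supp U" using j Js nth_mem unfolding enumerates_def faces_def V by blast
  have sub: "X \<subseteq> {1..k}" if "X \<subseteq> Supp U" for X
    using that U unfolding exps_def by blast
  have "Poly_Mapping.lookup (fmon k (2 * R) R U (?J - {p})) (face_exp k R U ?I) =
      Poly_Mapping.lookup (Poly_Mapping.single (?J - {p}) 1) ?I" for p
  proof -
    have Jp: "?J - {p} \<subseteq> Supp U" using J by blast
    have "face_exp k R U (?J - {p}) = face_exp k R U ?I \<longleftrightarrow> ?J - {p} = ?I"
      using face_exp_eqD(2)[OF _ U Jp U I, of R] R by fastforce
    then show ?thesis
      by (simp add: fmon_eq_xpow[OF sub[OF Jp]] xpow_def lookup_single when_def)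
  qed
  then have "monomial_coeff (fmon k (2 * R) R U ?I) (Sq k R (gmon k (2 * R) R (U - ind ?J) ?J)) =
      Poly_Mapping.lookup (boundary (Poly_Mapping.single ?J 1)) ?I"
    by (simp add: Sq_gmon[OF R U J] fmon_eq_xpow[OF sub[OF I]] monomial_coeff_xpow lookup_sum
        boundary_simplex)
  then show "Sq_mat k (2 * R) R U Is Js $$ (i, j) = boundary_mat Is Js $$ (i, j)"
    using i j by (simp add: Sq_mat_def boundary_mat_def)
qed (simp_all add: Sq_mat_def boundary_mat_def)

lemma fmon_eqD:
  assumes "R > 0"
    and "U \<in> exps k" "I \<subseteq> Supp U"
    and "V \<in> exps k" "I' \<subseteq> Supp V"
    and "fmon k (2 * R) R U I = fmon k (2 * R) R V I'"
  shows "U = V" and "I = I'"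
proof -
  have "I \<subseteq> {1..k}" "I' \<subseteq> {1..k}"
    using assms unfolding exps_def by blast+
  then have "face_exp k R U I = face_exp k R V I'"
    using assms(6) by (simp add: fmon_eq_xpow xpow_eq_iff)
  then show "U = V" "I = I'"
    using face_exp_eqD[OF assms(1-5)] by blast+
qed

lemma row_set_subset_homogeneous:
  assumes U: "U \<in> exps k" "weight U = N + q" and q: "q \<ge> 1"
  shows "row_set k (2 * R) R q U \<subseteq> homogeneous k (2 * R * N + (q + 1) * R)"
proof
  fix f assume "f \<in> row_set k (2 * R) R q U"
  then obtain I where I: "I \<subseteq> Supp U" "card I = q - 1" "f = fmon k (2 * R) R U I"
    by (auto simp: row_set_def faces_def)
  have "I \<subseteq> {1..k}" using I(1) U(1) unfolding exps_def by blast
  then have f: "f = xpow (face_exp k R U I)" using I(3) by (simp add: fmon_eq_xpow)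
  obtain r where r: "q = Suc r" using q by (cases q) auto
  have "weight (face_exp k R U I) = 2 * R * N + (q + 1) * R"
    using weight_face_exp[OF U(1) I(1), of R] I(2) U(2) r by (simp add: algebra_simps)
  then show "f \<in> homogeneous k (2 * R * N + (q + 1) * R)"
    by (simp add: f xpow_def homogeneous_def face_exp_in_exps)
qed

theorem proposition4p6:
  fixes k t R m q N d :: nat
  assumes "k \<ge> 1" and "R = 2 ^ t" and "m = 2 * R"
    and "1 \<le> q" and "q \<le> k"
    and "d = 2 * R * N + (q + 1) * R"
  shows
    "(\<forall>U\<in>exps k. weight U = N + q \<and> q \<le> card (Supp U) \<longrightarrow>
        inj_on (fmon k m R U) (faces (Supp U) (q - 1)) \<and>
        row_set k m R q U \<subseteq> homogeneous k d \<and>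
        (\<forall>J\<in>faces (Supp U) q.
           Sq k R (gmon k m R (U - ind J) J) = (\<Sum>p\<in>J. fmon k m R U (J - {p}))) \<and>
        (\<forall>Is Js. enumerates Is (faces (Supp U) (q - 1)) \<and> enumerates Js (faces (Supp U) q) \<longrightarrow>
           Sq_mat k m R U Is Js = boundary_mat Is Js \<and>
           mat_rank (Sq_mat k m R U Is Js) = (card (Supp U) - 1) choose (q - 1) \<and>
           (q = 1 \<longrightarrow>
              Sq_mat k m R U Is Js = mat 1 (card (Supp U)) (\<lambda>_. 1) \<and>
              mat_rank (Sq_mat k m R U Is Js) = 1))) \<and>
     (\<forall>U\<in>exps k. \<forall>V\<in>exps k.
        weight U = N + q \<and> q \<le> card (Supp U) \<and>
        weight V = N + q \<and> q \<le> card (Supp V) \<and> U \<noteq> V \<longrightarrow>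
        row_set k m R q U \<inter> row_set k m R q V = {})"
proof -
  have pos: "R > 0" using assms(2) by simp
  show ?thesis
  proof (intro conjI ballI impI allI)
    fix U assume U: "U \<in> exps k" and h: "weight U = N + q \<and> q \<le> card (Supp U)"
    have V: "finite (Supp U)" "Supp U \<noteq> {}"
      using h assms(4) by auto
    show "inj_on (fmon k m R U) (faces (Supp U) (q - 1))"
      using fmon_eqD(2)[OF pos U _ U] unfolding inj_on_def faces_def assms(3) by blast
    show "row_set k m R q U \<subseteq> homogeneous k d"
      using row_set_subset_homogeneous[OF U _ assms(4)] h unfolding assms(3,6) by blast
    show "Sq k R (gmon k m R (U - ind J) J) = (\<Sum>p\<in>J. fmon k m R U (J - {p}))"
      if "J \<in> faces (Supp U) q" for J
      using Sq_gmon[OF assms(2) U] that unfolding assms(3) faces_def by blast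
    fix Is Js
    assume "enumerates Is (faces (Supp U) (q - 1)) \<and> enumerates Js (faces (Supp U) q)"
    then have Is: "enumerates Is (faces (Supp U) (q - 1))" and Js: "enumerates Js (faces (Supp U) q)"
      by auto
    show eq: "Sq_mat k m R U Is Js = boundary_mat Is Js"
      unfolding assms(3) by (rule Sq_mat_eq_boundary_mat[OF assms(2) U refl Is Js])
    show rank: "mat_rank (Sq_mat k m R U Is Js) = (card (Supp U) - 1) choose (q - 1)"
      unfolding eq by (rule rank_boundary_mat[OF V assms(4) Is Js])
    assume q: "q = 1"
    show "Sq_mat k m R U Is Js = mat 1 (card (Supp U)) (\<lambda>_. 1)"
      unfolding eq using boundary_mat_vertices[OF V(1)] Is Js q by simp
    show "mat_rank (Sq_mat k m R U Is Js) = 1"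
      using rank q by simp
  next
    fix U V
    assume UV: "U \<in> exps k" "V \<in> exps k"
      and h: "weight U = N + q \<and> q \<le> card (Supp U) \<and>
        weight V = N + q \<and> q \<le> card (Supp V) \<and> U \<noteq> V"
    show "row_set k m R q U \<inter> row_set k m R q V = {}"
      using fmon_eqD(1)[OF pos UV(1) _ UV(2)] h unfolding row_set_def faces_def assms(3) by blast
  qed
qed

end
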